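(* Let $k\in\mathbb{N}$ and let $(\Lambda,d)$ be a row-finite $k$-graph. Let $\mathcal{K}=\{\mathcal{K}_F\}_{F\subseteq[k]}$ and $\mathcal{L}=\{\mathcal{L}_F\}_{F\subseteq[k]}$ be $2^k$-tuples of the associated product system $X(\Lambda)$ and suppose that $\mathcal{K}$ consists of ideals. Then $\mathcal{L}$ is a $\mathcal{K}$-relative O-family of $X(\Lambda)$ if and only if the following three conditions hold: (i) $\mathcal{L}$ consists of ideals of $c_0(\Lambda^{\underline{0}})$, (ii) $H_{\mathcal{L},F}=\{v\in\Lambda^{\underline{0}}: s(v\Lambda^{\underline{i}})\subseteq H_{\mathcal{L},F}\}\cap H_{\mathcal{L},F\cup\{i\}}$ for all $F\subsetneq[k]$ and $i\in[k]\setminus F$, and (iii) $H_{\mathcal{K},F}\subseteq H_{\mathcal{L},F}$ for all $F\subseteq[k]$.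
   Context: Ideals of C*-algebras are two-sided and norm-closed. $\mathbb{Z}_+=\{0,1,\dots\}$, $[k]=\{1,\dots,k\}$, and $\underline{i}$ ($i\in[k]$) are the standard generators of $\mathbb{Z}_+^k$. A $k$-graph $(\Lambda,d)$ is a countable small category $\Lambda$ with range and source maps $r,s$ and a functor $d:\Lambda\to\mathbb{Z}_+^k$ (so $d(\lambda\mu)=d(\lambda)+d(\mu)$ when $s(\lambda)=r(\mu)$, and $d(\mathrm{id}_v)=\underline{0}$) with the factorisation property: whenever $d(\lambda)=\underline{m}+\underline{n}$ there are unique morphisms $\mu,\nu$ with $d(\mu)=\underline{m}$, $d(\nu)=\underline{n}$, $\lambda=\mu\nu$. Objects (vertices) are identified with morphisms of degree $\underline{0}$. $\Lambda^{\underline{n}}=\{\lambda\in\Lambda:d(\lambda)=\underline{n}\}$ and $v\Lambda^{\underline{n}}=\{\lambda\in\Lambda^{\underline{n}}:r(\lambda)=v\}$. $(\Lambda,d)$ is row-finite if $|v\Lambda^{\underline{n}}|<\infty$ for all $v\in\Lambda^{\underline{0}}$, $\underline{n}\in\mathbb{Z}_+^k$. The associated product system $X(\Lambda)=\{X_{\underline{n}}(\Lambda)\}_{\underline{n}\in\mathbb{Z}_+^k}$ has coefficients in $c_0(\Lambda^{\underline{0}})$ ($\Lambda^{\underline{0}}$ discrete). $X_{\underline{0}}(\Lambda)=c_0(\Lambda^{\underline{0}})$. For $\underline{n}\ne\underline{0}$, $X_{\underline{n}}(\Lambda)$ is the Hilbert module completion of $c_{00}(\Lambda^{\underline{n}})$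 (finitely supported functions) under $\langle\xi,\eta\rangle(v)=\sum_{s(\lambda)=v}\overline{\xi(\lambda)}\eta(\lambda)$ and $(\xi a)(\lambda)=\xi(\lambda)a(s(\lambda))$, with left action induced by $(\phi_{\underline{n}}(a)\xi)(\lambda)=a(r(\lambda))\xi(\lambda)$. Multiplication is determined by $\delta_\lambda\otimes\delta_\mu\mapsto\delta_{\lambda\mu}$ if $r(\mu)=s(\lambda)$ and $0$ otherwise. When $(\Lambda,d)$ is row-finite, $X(\Lambda)$ is a proper product system (left actions by compact operators). For an ideal $I\subseteq c_0(\Lambda^{\underline{0}})$, set $H_I=\{v\in\Lambda^{\underline{0}}:\delta_v\in I\}$; for a family $\mathcal{L}$ of ideals, $H_{\mathcal{L},F}=H_{\mathcal{L}_F}$. Write $A=c_0(\Lambda^{\underline{0}})$ and $X_{\underline{n}}=X_{\underline{n}}(\Lambda)$. For an ideal $I\subseteq A$, $X_{\underline{n}}^{-1}(I)=\{a\in A:\langle\xi,\phi_{\underline{n}}(a)\eta\rangle\in I\text{ for all }\xi,\eta\in X_{\underline{n}}\}$. A $2^k$-tuple of $X(\Lambda)$ is a family $\{\mathcal{L}_F\}_{F\subseteq[k]}$ of non-empty subsets of $A$. A T-family is a $2^k$-tuple $\mathcal{L}$ consisting of ideals with $\mathcal{L}_F=X_{\underline{i}}^{-1}(\mathcal{L}_F)\cap\mathcal{L}_{F\cup\{i\}}$ for all $F\subsetneq[k]$, $i\in[k]\setminus F$. A $\mathcal{K}$-relative O-family is a T-family $\mathcal{L}$ with $\mathcal{K}_F\subseteq\mathcal{L}_F$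 for all $F\subseteq[k]$. *)

theory Defs
  imports "HOL-Analysis.Analysis" "HOL-Library.Function_Algebras"
begin

section \<open>Higher-rank graphs\<close>

text \<open>
  Small categories are given by their morphisms alone: an object is identified with its identity
  morphism, and \<open>rng\<close> and \<open>src\<close> take values in these identities. The composite \<open>cmp \<lambda> \<mu>\<close>
  (written \<open>\<lambda>\<mu>\<close> in comments) is meaningful when \<open>src \<lambda> = rng \<mu>\<close>.
\<close>

record 'm kgraph =
  mor :: "'m set"
  rng :: "'m \<Rightarrow> 'm"
  src :: "'m \<Rightarrow> 'm"
  cmp :: "'m \<Rightarrow> 'm \<Rightarrow> 'm"
  deg :: "'m \<Rightarrow> nat \<Rightarrow> nat"

locale small_category =
  fixes \<Lambda> :: "'m kgraph"
  assumes rng_mor: "x \<in> mor \<Lambda> \<Longrightarrow> rng \<Lambda> x \<in> mor \<Lambda>"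
    and src_mor: "x \<in> mor \<Lambda> \<Longrightarrow> src \<Lambda> x \<in> mor \<Lambda>"
    and rng_rng: "x \<in> mor \<Lambda> \<Longrightarrow> rng \<Lambda> (rng \<Lambda> x) = rng \<Lambda> x"
    and src_rng: "x \<in> mor \<Lambda> \<Longrightarrow> src \<Lambda> (rng \<Lambda> x) = rng \<Lambda> x"
    and rng_src: "x \<in> mor \<Lambda> \<Longrightarrow> rng \<Lambda> (src \<Lambda> x) = src \<Lambda> x"
    and src_src: "x \<in> mor \<Lambda> \<Longrightarrow> src \<Lambda> (src \<Lambda> x) = src \<Lambda> x"
    and cmp_mor: "x \<in> mor \<Lambda> \<Longrightarrow> y \<in> mor \<Lambda> \<Longrightarrow> src \<Lambda> x = rng \<Lambda> y \<Longrightarrow> cmp \<Lambda> x y \<in> mor \<Lambda>"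
    and rng_cmp: "x \<in> mor \<Lambda> \<Longrightarrow> y \<in> mor \<Lambda> \<Longrightarrow> src \<Lambda> x = rng \<Lambda> y \<Longrightarrow>
      rng \<Lambda> (cmp \<Lambda> x y) = rng \<Lambda> x"
    and src_cmp: "x \<in> mor \<Lambda> \<Longrightarrow> y \<in> mor \<Lambda> \<Longrightarrow> src \<Lambda> x = rng \<Lambda> y \<Longrightarrow>
      src \<Lambda> (cmp \<Lambda> x y) = src \<Lambda> y"
    and cmp_assoc: "x \<in> mor \<Lambda> \<Longrightarrow> y \<in> mor \<Lambda> \<Longrightarrow> z \<in> mor \<Lambda> \<Longrightarrow>
      src \<Lambda> x = rng \<Lambda> y \<Longrightarrow> src \<Lambda> y = rng \<Lambda> z \<Longrightarrow>
      cmp \<Lambda> (cmp \<Lambda> x y) z = cmp \<Lambda> x (cmp \<Lambda> y z)"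
    and cmp_rng: "x \<in> mor \<Lambda> \<Longrightarrow> cmp \<Lambda> (rng \<Lambda> x) x = x"
    and cmp_src: "x \<in> mor \<Lambda> \<Longrightarrow> cmp \<Lambda> x (src \<Lambda> x) = x"

text \<open>\<open>\<int>\<^sub>+\<^sup>k\<close>: the functions \<open>nat \<Rightarrow> nat\<close> vanishing outside \<open>[k] = {1..k}\<close>, added pointwise. Its
  generator for \<open>i \<in> [k]\<close> is \<open>indicator {i}\<close>.\<close>

definition degrees :: "nat \<Rightarrow> (nat \<Rightarrow> nat) set" where
  "degrees k = {n. \<forall>i. i \<notin> {1..k} \<longrightarrow> n i = 0}"

locale k_graph = small_category +
  fixes k :: nat
  assumes countable_mor: "countable (mor \<Lambda>)"
    and deg_degrees: "x \<in> mor \<Lambda> \<Longrightarrow> deg \<Lambda> x \<in> degrees k"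
    and deg_cmp: "x \<in> mor \<Lambda> \<Longrightarrow> y \<in> mor \<Lambda> \<Longrightarrow> src \<Lambda> x = rng \<Lambda> y \<Longrightarrow>
      deg \<Lambda> (cmp \<Lambda> x y) = deg \<Lambda> x + deg \<Lambda> y"
    and deg_id: "x \<in> mor \<Lambda> \<Longrightarrow> deg \<Lambda> (rng \<Lambda> x) = 0"
    and factorisation: "x \<in> mor \<Lambda> \<Longrightarrow> m \<in> degrees k \<Longrightarrow> n \<in> degrees k \<Longrightarrow> deg \<Lambda> x = m + n \<Longrightarrow>
      \<exists>!(y, z). y \<in> mor \<Lambda> \<and> z \<in> mor \<Lambda> \<and> src \<Lambda> y = rng \<Lambda> z \<and>
        deg \<Lambda> y = m \<and> deg \<Lambda> z = n \<and> x = cmp \<Lambda> y z"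

definition paths :: "'m kgraph \<Rightarrow> (nat \<Rightarrow> nat) \<Rightarrow> 'm set" where
  "paths \<Lambda> n = {x \<in> mor \<Lambda>. deg \<Lambda> x = n}"

abbreviation verts :: "'m kgraph \<Rightarrow> 'm set" where
  "verts \<Lambda> \<equiv> paths \<Lambda> 0"

text \<open>\<open>v\<Lambda>\<^sup>n\<close>\<close>

definition paths_to :: "'m kgraph \<Rightarrow> 'm \<Rightarrow> (nat \<Rightarrow> nat) \<Rightarrow> 'm set" where
  "paths_to \<Lambda> v n = {x \<in> paths \<Lambda> n. rng \<Lambda> x = v}"

definition row_finite :: "nat \<Rightarrow> 'm kgraph \<Rightarrow> bool" where
  "row_finite k \<Lambda> \<longleftrightarrow> (\<forall>v \<in> verts \<Lambda>. \<forall>n \<in> degrees k. finite (paths_to \<Lambda> v n))"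

lemma (in k_graph) verts_eq_identities: "verts \<Lambda> = {x \<in> mor \<Lambda>. rng \<Lambda> x = x}"
proof -
  have 0: "0 \<in> degrees k" by (simp add: degrees_def)
  have "rng \<Lambda> x = x" if x: "x \<in> mor \<Lambda>" "deg \<Lambda> x = 0" for x
  proof -
    have s: "deg \<Lambda> (src \<Lambda> x) = 0"
      using deg_id[OF src_mor[OF x(1)]] rng_src[OF x(1)] by simp
    from factorisation[OF x(1) 0 0] x(2)
    have u: "\<exists>!(y, z). y \<in> mor \<Lambda> \<and> z \<in> mor \<Lambda> \<and> src \<Lambda> y = rng \<Lambda> z \<and>
        deg \<Lambda> y = 0 \<and> deg \<Lambda> z = 0 \<and> x = cmp \<Lambda> y z" by simp
    have "(rng \<Lambda> x, x) = (x, src \<Lambda> x)"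
      by (rule ex1E[OF u])
        (use x s in \<open>auto simp: rng_mor src_mor src_rng rng_src deg_id cmp_rng cmp_src\<close>)
    then show ?thesis by simp
  qed
  moreover have "deg \<Lambda> x = 0" if "x \<in> mor \<Lambda>" "rng \<Lambda> x = x" for x
    using deg_id[OF that(1)] that(2) by simp
  ultimately show ?thesis by (auto simp: paths_def)
qed


section \<open>The coefficient algebra and its ideals\<close>

text \<open>Functions on a set of morphisms are total functions vanishing outside it; the algebraic
  operations are pointwise.\<close>

definition c0 :: "'m set \<Rightarrow> ('m \<Rightarrow> complex) set" where
  "c0 V = {f. (\<forall>v. v \<notin> V \<longrightarrow> f v = 0) \<and> (\<forall>\<epsilon>>0. finite {v \<in> V. cmod (f v) \<ge> \<epsilon>})}"

definition sup_norm :: "('m \<Rightarrow> complex) \<Rightarrow> real" where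
  "sup_norm f = (SUP v. cmod (f v))"

text \<open>Norm-closed two-sided ideals of an algebra \<open>A\<close> of bounded functions.\<close>

definition closed_ideal :: "('m \<Rightarrow> complex) set \<Rightarrow> ('m \<Rightarrow> complex) set \<Rightarrow> bool" where
  "closed_ideal A I \<longleftrightarrow>
     I \<subseteq> A \<and> 0 \<in> I \<and>
     (\<forall>f \<in> I. \<forall>g \<in> I. f + g \<in> I) \<and>
     (\<forall>c. \<forall>f \<in> I. (\<lambda>v. c * f v) \<in> I) \<and>
     (\<forall>a \<in> A. \<forall>f \<in> I. a * f \<in> I \<and> f * a \<in> I) \<and>
     (\<forall>f \<in> A. (\<forall>\<epsilon>>0. \<exists>g \<in> I. sup_norm (f - g) < \<epsilon>) \<longrightarrow> f \<in> I)"

abbreviation coeff :: "'m kgraph \<Rightarrow> ('m \<Rightarrow> complex) set" where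
  "coeff \<Lambda> \<equiv> c0 (verts \<Lambda>)"


section \<open>The modules of the product system\<close>

text \<open>Only the Hilbert modules and their left actions enter the notions below; the right action
  and the multiplication of the product system do not.\<close>

definition inner_prod ::
  "'m kgraph \<Rightarrow> (nat \<Rightarrow> nat) \<Rightarrow> ('m \<Rightarrow> complex) \<Rightarrow> ('m \<Rightarrow> complex) \<Rightarrow> 'm \<Rightarrow> complex" where
  "inner_prod \<Lambda> n \<xi> \<eta> = (\<lambda>v. \<Sum>\<^sub>\<infinity>x \<in> {x \<in> paths \<Lambda> n. src \<Lambda> x = v}. cnj (\<xi> x) * \<eta> x)"

definition left_act ::
  "'m kgraph \<Rightarrow> ('m \<Rightarrow> complex) \<Rightarrow> ('m \<Rightarrow> complex) \<Rightarrow> 'm \<Rightarrow> complex" where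
  "left_act \<Lambda> a \<xi> = (\<lambda>x. a (rng \<Lambda> x) * \<xi> x)"

definition mod_norm :: "'m kgraph \<Rightarrow> (nat \<Rightarrow> nat) \<Rightarrow> ('m \<Rightarrow> complex) \<Rightarrow> real" where
  "mod_norm \<Lambda> n \<xi> = sqrt (sup_norm (inner_prod \<Lambda> n \<xi> \<xi>))"

definition c00 :: "'m set \<Rightarrow> ('m \<Rightarrow> complex) set" where
  "c00 P = {\<xi>. (\<forall>x. x \<notin> P \<longrightarrow> \<xi> x = 0) \<and> finite {x. \<xi> x \<noteq> 0}}"

text \<open>The functions of finite module norm. The Hilbert module completion of \<open>c00 (paths \<Lambda> n)\<close> is
  realised as the closure of \<open>c00 (paths \<Lambda> n)\<close> among them; it is indeed complete, by
  \<open>fibre_complete\<close> below. For \<open>n = 0\<close> it is the coefficient algebra, by \<open>fibre_0\<close>.\<close>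

definition bounded_sections :: "'m kgraph \<Rightarrow> (nat \<Rightarrow> nat) \<Rightarrow> ('m \<Rightarrow> complex) set" where
  "bounded_sections \<Lambda> n = {\<xi>. (\<forall>x. x \<notin> paths \<Lambda> n \<longrightarrow> \<xi> x = 0) \<and>
     (\<forall>v. (\<lambda>x. cnj (\<xi> x) * \<xi> x) summable_on {x \<in> paths \<Lambda> n. src \<Lambda> x = v}) \<and>
     bounded (range (inner_prod \<Lambda> n \<xi> \<xi>))}"

definition fibre :: "'m kgraph \<Rightarrow> (nat \<Rightarrow> nat) \<Rightarrow> ('m \<Rightarrow> complex) set" where
  "fibre \<Lambda> n = {\<xi> \<in> bounded_sections \<Lambda> n.
     \<forall>\<epsilon>>0. \<exists>\<eta> \<in> c00 (paths \<Lambda> n). mod_norm \<Lambda> n (\<xi> - \<eta>) < \<epsilon>}"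

text \<open>\<open>X\<^sub>n\<^sup>-\<^sup>1(I)\<close>\<close>

definition fibre_inv ::
  "'m kgraph \<Rightarrow> (nat \<Rightarrow> nat) \<Rightarrow> ('m \<Rightarrow> complex) set \<Rightarrow> ('m \<Rightarrow> complex) set" where
  "fibre_inv \<Lambda> n I = {a \<in> coeff \<Lambda>.
     \<forall>\<xi> \<in> fibre \<Lambda> n. \<forall>\<eta> \<in> fibre \<Lambda> n. inner_prod \<Lambda> n \<xi> (left_act \<Lambda> a \<eta>) \<in> I}"

lemma bounded_sections_iff:
  assumes "c \<ge> 0"
  shows "\<xi> \<in> bounded_sections \<Lambda> n \<and> mod_norm \<Lambda> n \<xi> \<le> c \<longleftrightarrow>
    (\<forall>x. x \<notin> paths \<Lambda> n \<longrightarrow> \<xi> x = 0) \<and>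
    (\<forall>v F. finite F \<longrightarrow> F \<subseteq> {x \<in> paths \<Lambda> n. src \<Lambda> x = v} \<longrightarrow> (\<Sum>x\<in>F. (cmod (\<xi> x))\<^sup>2) \<le> c\<^sup>2)"
    (is "?L \<longleftrightarrow> ?S \<and> ?R")
proof -
  let ?P = "\<lambda>v. {x \<in> paths \<Lambda> n. src \<Lambda> x = v}"
  let ?N = "inner_prod \<Lambda> n \<xi> \<xi>"
  have eq: "cnj (\<xi> x) * \<xi> x = of_real ((cmod (\<xi> x))\<^sup>2)" for x
    using complex_norm_square[of "\<xi> x"] by (simp add: mult.commute)
  have sm: "(\<lambda>x. cnj (\<xi> x) * \<xi> x) summable_on A \<longleftrightarrow> (\<lambda>x. (cmod (\<xi> x))\<^sup>2) summable_on A" for A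
    unfolding eq
    using summable_on_of_real[of "\<lambda>x. (cmod (\<xi> x))\<^sup>2" A, where 'a = complex]
      summable_on_Re[of "\<lambda>x. complex_of_real ((cmod (\<xi> x))\<^sup>2)" A]
    unfolding Re_complex_of_real by blast
  have N: "?N v = of_real (\<Sum>\<^sub>\<infinity>x\<in>?P v. (cmod (\<xi> x))\<^sup>2)"
    if "(\<lambda>x. (cmod (\<xi> x))\<^sup>2) summable_on ?P v" for v
    unfolding inner_prod_def eq
    by (rule infsumI[OF has_sum_of_real[OF has_sum_infsum[OF that]]])
  have cN: "cmod (?N v) = (\<Sum>\<^sub>\<infinity>x\<in>?P v. (cmod (\<xi> x))\<^sup>2)"
    if "(\<lambda>x. (cmod (\<xi> x))\<^sup>2) summable_on ?P v" for v
    unfolding N[OF that] norm_of_real by (simp add: infsum_nonneg)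
  show ?thesis
  proof
    assume L: ?L
    then have S: ?S and s: "\<And>v. (\<lambda>x. (cmod (\<xi> x))\<^sup>2) summable_on ?P v"
      and b: "bounded (range ?N)"
      by (auto simp: bounded_sections_def sm)
    have bdd: "bdd_above (range (\<lambda>v. cmod (?N v)))"
      using b by (auto simp: bounded_iff bdd_above_def)
    have ge: "cmod (?N v) \<le> sup_norm ?N" for v
      unfolding sup_norm_def by (rule cSUP_upper[OF _ bdd]) simp
    have "sup_norm ?N \<le> c\<^sup>2"
      using L by (simp add: mod_norm_def real_le_rsqrt sqrt_le_D)
    with ge have "(\<Sum>\<^sub>\<infinity>x\<in>?P v. (cmod (\<xi> x))\<^sup>2) \<le> c\<^sup>2" for v
      using order_trans cN[OF s] by metis
    moreover have "(\<Sum>x\<in>F. (cmod (\<xi> x))\<^sup>2) \<le> (\<Sum>\<^sub>\<infinity>x\<in>?P v. (cmod (\<xi> x))\<^sup>2)"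
      if "finite F" "F \<subseteq> ?P v" for F v
      by (rule finite_sum_le_infsum[OF s that]) simp
    ultimately show "?S \<and> ?R" using S by (meson order_trans)
  next
    assume "?S \<and> ?R"
    then have S: ?S and R: "\<And>v F. finite F \<Longrightarrow> F \<subseteq> ?P v \<Longrightarrow> (\<Sum>x\<in>F. (cmod (\<xi> x))\<^sup>2) \<le> c\<^sup>2"
      by blast+
    have s: "(\<lambda>x. (cmod (\<xi> x))\<^sup>2) summable_on ?P v" for v
      by (rule nonneg_bdd_above_summable_on) (use R in \<open>auto simp: bdd_above_def\<close>)
    have le: "cmod (?N v) \<le> c\<^sup>2" for v
      unfolding cN[OF s] by (rule infsum_le_finite_sums[OF s R]) auto
    then have b: "bounded (range ?N)" by (auto simp: bounded_iff)
    have "sup_norm ?N \<le> c\<^sup>2"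
      unfolding sup_norm_def by (rule cSUP_least) (use le in auto)
    then have "mod_norm \<Lambda> n \<xi> \<le> c"
      unfolding mod_norm_def using assms by (simp add: real_le_lsqrt real_sqrt_le_iff')
    then show ?L using S s b by (simp add: bounded_sections_def sm)
  qed
qed

lemma mod_norm_nonneg: "\<xi> \<in> bounded_sections \<Lambda> n \<Longrightarrow> mod_norm \<Lambda> n \<xi> \<ge> 0"
proof -
  assume "\<xi> \<in> bounded_sections \<Lambda> n"
  then have "bdd_above (range (\<lambda>v. cmod (inner_prod \<Lambda> n \<xi> \<xi> v)))"
    by (auto simp: bounded_sections_def bounded_iff bdd_above_def)
  from cSUP_upper[OF _ this, of undefined]
  have "0 \<le> sup_norm (inner_prod \<Lambda> n \<xi> \<xi>)"
    unfolding sup_norm_def using order_trans[OF norm_ge_zero] by fastforce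
  then show ?thesis by (simp add: mod_norm_def)
qed

lemma mod_norm_sum_le:
  assumes "\<xi> \<in> bounded_sections \<Lambda> n" "finite F" "F \<subseteq> {x \<in> paths \<Lambda> n. src \<Lambda> x = v}"
  shows "(\<Sum>x\<in>F. (cmod (\<xi> x))\<^sup>2) \<le> (mod_norm \<Lambda> n \<xi>)\<^sup>2"
  using bounded_sections_iff[OF mod_norm_nonneg[OF assms(1)], of \<xi> \<Lambda> n] assms by blast

lemma mod_norm_pointwise_le:
  assumes "\<xi> \<in> bounded_sections \<Lambda> n"
  shows "cmod (\<xi> x) \<le> mod_norm \<Lambda> n \<xi>"
proof (cases "x \<in> paths \<Lambda> n")
  case True
  with mod_norm_sum_le[OF assms, of "{x}" "src \<Lambda> x"]
  have "(cmod (\<xi> x))\<^sup>2 \<le> (mod_norm \<Lambda> n \<xi>)\<^sup>2" by simp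
  then show ?thesis using mod_norm_nonneg[OF assms] power2_le_imp_le by blast
next
  case False
  then show ?thesis using assms mod_norm_nonneg[OF assms] by (simp add: bounded_sections_def)
qed

lemma bounded_sections_diff:
  assumes "\<xi> \<in> bounded_sections \<Lambda> n" "\<eta> \<in> bounded_sections \<Lambda> n"
  shows "\<xi> - \<eta> \<in> bounded_sections \<Lambda> n \<and>
    mod_norm \<Lambda> n (\<xi> - \<eta>) \<le> 2 * (mod_norm \<Lambda> n \<xi> + mod_norm \<Lambda> n \<eta>)"
proof -
  let ?a = "mod_norm \<Lambda> n \<xi>" and ?b = "mod_norm \<Lambda> n \<eta>"
  have nn: "?a \<ge> 0" "?b \<ge> 0" using assms by (auto intro: mod_norm_nonneg)
  have pt: "(cmod (u - w))\<^sup>2 \<le> 2 * (cmod u)\<^sup>2 + 2 * (cmod w)\<^sup>2" for u w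
  proof -
    have "(cmod (u - w))\<^sup>2 \<le> (cmod u + cmod w)\<^sup>2"
      by (intro power_mono norm_triangle_ineq4) simp
    also have "\<dots> \<le> 2 * (cmod u)\<^sup>2 + 2 * (cmod w)\<^sup>2"
      using sum_squares_bound[of "cmod u" "cmod w"] by (simp add: power2_sum)
    finally show ?thesis .
  qed
  have "(\<Sum>x\<in>F. (cmod ((\<xi> - \<eta>) x))\<^sup>2) \<le> (2 * (?a + ?b))\<^sup>2"
    if F: "finite F" "F \<subseteq> {x \<in> paths \<Lambda> n. src \<Lambda> x = v}" for F v
  proof -
    have "(\<Sum>x\<in>F. (cmod ((\<xi> - \<eta>) x))\<^sup>2) \<le> (\<Sum>x\<in>F. 2 * (cmod (\<xi> x))\<^sup>2 + 2 * (cmod (\<eta> x))\<^sup>2)"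
      by (intro sum_mono) (simp add: pt)
    also have "\<dots> = 2 * (\<Sum>x\<in>F. (cmod (\<xi> x))\<^sup>2) + 2 * (\<Sum>x\<in>F. (cmod (\<eta> x))\<^sup>2)"
      by (simp add: sum.distrib sum_distrib_left)
    also have "\<dots> \<le> 2 * ?a\<^sup>2 + 2 * ?b\<^sup>2"
      using mod_norm_sum_le[OF assms(1) F] mod_norm_sum_le[OF assms(2) F] by simp
    also have "\<dots> \<le> (2 * (?a + ?b))\<^sup>2"
      using nn by (simp add: power2_eq_square algebra_simps)
    finally show ?thesis .
  qed
  moreover have "\<forall>x. x \<notin> paths \<Lambda> n \<longrightarrow> (\<xi> - \<eta>) x = 0"
    using assms by (simp add: bounded_sections_def)
  ultimately show ?thesis
    using bounded_sections_iff[of "2 * (?a + ?b)" "\<xi> - \<eta>" \<Lambda> n] nn by auto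
qed

lemma c00_subset_fibre: "c00 (paths \<Lambda> n) \<subseteq> fibre \<Lambda> n"
proof
  fix \<xi> assume \<xi>: "\<xi> \<in> c00 (paths \<Lambda> n)"
  define c where "c = (\<Sum>x | \<xi> x \<noteq> 0. (cmod (\<xi> x))\<^sup>2)"
  have fin: "finite {x. \<xi> x \<noteq> 0}" using \<xi> by (simp add: c00_def)
  have "(\<Sum>x\<in>F. (cmod (\<xi> x))\<^sup>2) \<le> (sqrt c)\<^sup>2" if "finite F" for F
  proof -
    have "(\<Sum>x\<in>F. (cmod (\<xi> x))\<^sup>2) = (\<Sum>x\<in>F \<inter> {x. \<xi> x \<noteq> 0}. (cmod (\<xi> x))\<^sup>2)"
      by (rule sum.mono_neutral_right) (use that in auto)
    also have "\<dots> \<le> c" unfolding c_def by (rule sum_mono2) (use fin in auto)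
    also have "c = (sqrt c)\<^sup>2" by (simp add: c_def sum_nonneg)
    finally show ?thesis .
  qed
  then have "\<xi> \<in> bounded_sections \<Lambda> n"
    using bounded_sections_iff[of "sqrt c" \<xi> \<Lambda> n] \<xi> by (auto simp: c00_def c_def sum_nonneg)
  moreover have "mod_norm \<Lambda> n (\<xi> - \<xi>) = 0"
    by (simp add: mod_norm_def sup_norm_def inner_prod_def)
  ultimately show "\<xi> \<in> fibre \<Lambda> n" using \<xi> unfolding fibre_def by force
qed

lemma fibre_complete:
  assumes fib: "\<And>j. X j \<in> fibre \<Lambda> n"
    and cauchy: "\<And>\<epsilon>. \<epsilon> > 0 \<Longrightarrow> \<exists>N. \<forall>i\<ge>N. \<forall>j\<ge>N. mod_norm \<Lambda> n (X i - X j) < \<epsilon>"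
  shows "\<exists>\<xi> \<in> fibre \<Lambda> n. (\<lambda>j. mod_norm \<Lambda> n (X j - \<xi>)) \<longlonglongrightarrow> 0"
proof -
  have bs: "X j \<in> bounded_sections \<Lambda> n" for j using fib by (simp add: fibre_def)
  have bsd: "X i - X j \<in> bounded_sections \<Lambda> n" for i j using bounded_sections_diff[OF bs bs] by blast
  have "Cauchy (\<lambda>j. X j x)" for x
  proof (rule metric_CauchyI)
    fix e :: real assume "e > 0"
    from cauchy[OF this] obtain N where N: "\<forall>i\<ge>N. \<forall>j\<ge>N. mod_norm \<Lambda> n (X i - X j) < e" by blast
    have "dist (X i x) (X j x) < e" if "i \<ge> N" "j \<ge> N" for i j
      using mod_norm_pointwise_le[OF bsd[of i j], of x] N that by (auto simp: dist_norm intro: le_less_trans)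
    then show "\<exists>M. \<forall>m\<ge>M. \<forall>k\<ge>M. dist (X m x) (X k x) < e" by blast
  qed
  then obtain \<xi> where lim: "\<And>x. (\<lambda>j. X j x) \<longlonglongrightarrow> \<xi> x"
    unfolding Cauchy_convergent_iff convergent_def by metis
  have key: "\<exists>N. \<forall>i\<ge>N. X i - \<xi> \<in> bounded_sections \<Lambda> n \<and> mod_norm \<Lambda> n (X i - \<xi>) \<le> \<epsilon>"
    if "\<epsilon> > 0" for \<epsilon>
  proof -
    from cauchy[OF that] obtain N where N: "\<forall>i\<ge>N. \<forall>j\<ge>N. mod_norm \<Lambda> n (X i - X j) < \<epsilon>" by blast
    have "X i - \<xi> \<in> bounded_sections \<Lambda> n \<and> mod_norm \<Lambda> n (X i - \<xi>) \<le> \<epsilon>" if i: "i \<ge> N" for i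
    proof -
      have "(\<Sum>x\<in>F. (cmod ((X i - \<xi>) x))\<^sup>2) \<le> \<epsilon>\<^sup>2"
        if F: "finite F" "F \<subseteq> {x \<in> paths \<Lambda> n. src \<Lambda> x = v}" for F v
      proof (rule LIMSEQ_le_const2)
        show "(\<lambda>j. \<Sum>x\<in>F. (cmod ((X i - X j) x))\<^sup>2) \<longlonglongrightarrow> (\<Sum>x\<in>F. (cmod ((X i - \<xi>) x))\<^sup>2)"
          by (auto intro!: tendsto_intros lim)
        have "(\<Sum>x\<in>F. (cmod ((X i - X j) x))\<^sup>2) \<le> \<epsilon>\<^sup>2" if "j \<ge> N" for j
        proof -
          have "(\<Sum>x\<in>F. (cmod ((X i - X j) x))\<^sup>2) \<le> (mod_norm \<Lambda> n (X i - X j))\<^sup>2"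
            by (rule mod_norm_sum_le[OF bsd F])
          also have "\<dots> \<le> \<epsilon>\<^sup>2"
            using N i that mod_norm_nonneg[OF bsd] by (intro power_mono) (auto intro: less_imp_le)
          finally show ?thesis .
        qed
        then show "\<exists>N. \<forall>j\<ge>N. (\<Sum>x\<in>F. (cmod ((X i - X j) x))\<^sup>2) \<le> \<epsilon>\<^sup>2" by blast
      qed
      moreover have "(X i - \<xi>) x = 0" if "x \<notin> paths \<Lambda> n" for x
      proof -
        have "X j x = 0" for j using bs that by (simp add: bounded_sections_def)
        then show ?thesis using lim[of x] by (simp add: LIMSEQ_const_iff)
      qed
      ultimately show ?thesis
        using bounded_sections_iff[of \<epsilon> "X i - \<xi>" \<Lambda> n] \<open>\<epsilon> > 0\<close> by auto
    qed
    then show ?thesis by blast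
  qed
  obtain N where N: "X N - \<xi> \<in> bounded_sections \<Lambda> n" using key[of 1] by auto
  have "X N - (X N - \<xi>) \<in> bounded_sections \<Lambda> n" using bounded_sections_diff[OF bs N] by blast
  then have \<xi>b: "\<xi> \<in> bounded_sections \<Lambda> n" by (simp add: fun_diff_def)
  have "\<exists>\<eta> \<in> c00 (paths \<Lambda> n). mod_norm \<Lambda> n (\<xi> - \<eta>) < \<epsilon>" if e: "\<epsilon> > 0" for \<epsilon>
  proof -
    from key[of "\<epsilon> / 8"] e obtain i where
      i: "X i - \<xi> \<in> bounded_sections \<Lambda> n" "mod_norm \<Lambda> n (X i - \<xi>) \<le> \<epsilon> / 8" by auto
    have "\<epsilon> / 8 > 0" using e by simp
    then obtain \<eta> where
      \<eta>: "\<eta> \<in> c00 (paths \<Lambda> n)" "mod_norm \<Lambda> n (X i - \<eta>) < \<epsilon> / 8"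
      using fib[of i] unfolding fibre_def by blast
    have "\<eta> \<in> bounded_sections \<Lambda> n" using \<eta> c00_subset_fibre by (auto simp: fibre_def)
    then have d: "X i - \<eta> \<in> bounded_sections \<Lambda> n" using bounded_sections_diff[OF bs] by blast
    have "t < \<epsilon>" if "t \<le> 2 * (a + b)" "a < \<epsilon> / 8" "b \<le> \<epsilon> / 8" for t a b :: real
      using that e by (simp add: field_simps)
    then have "mod_norm \<Lambda> n ((X i - \<eta>) - (X i - \<xi>)) < \<epsilon>"
      using conjunct2[OF bounded_sections_diff[OF d i(1)]] i(2) \<eta>(2) by blast
    moreover have "(X i - \<eta>) - (X i - \<xi>) = \<xi> - \<eta>" by (auto simp: fun_eq_iff)
    ultimately show ?thesis using \<eta>(1) by auto
  qed
  then have "\<xi> \<in> fibre \<Lambda> n" using \<xi>b by (simp add: fibre_def)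
  moreover have "(\<lambda>j. mod_norm \<Lambda> n (X j - \<xi>)) \<longlonglongrightarrow> 0"
  proof (rule LIMSEQ_I)
    fix r :: real assume r: "r > 0"
    from key[of "r / 2"] r obtain M where
      M: "\<forall>i\<ge>M. X i - \<xi> \<in> bounded_sections \<Lambda> n \<and> mod_norm \<Lambda> n (X i - \<xi>) \<le> r / 2" by auto
    then show "\<exists>no. \<forall>j\<ge>no. norm (mod_norm \<Lambda> n (X j - \<xi>) - 0) < r"
      using mod_norm_nonneg r by (intro exI[of _ M]) fastforce
  qed
  ultimately show ?thesis by blast
qed

lemma (in k_graph) fibre_0: "fibre \<Lambda> 0 = coeff \<Lambda>"
proof -
  have src: "src \<Lambda> x = x" if "x \<in> verts \<Lambda>" for x
    using that src_rng verts_eq_identities by force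
  have P: "{x \<in> verts \<Lambda>. src \<Lambda> x = v} = (if v \<in> verts \<Lambda> then {v} else {})" for v
    using src by auto
  have char: "\<xi> \<in> bounded_sections \<Lambda> 0 \<and> mod_norm \<Lambda> 0 \<xi> \<le> c \<longleftrightarrow>
    (\<forall>x. x \<notin> verts \<Lambda> \<longrightarrow> \<xi> x = 0) \<and> (\<forall>x. cmod (\<xi> x) \<le> c)" (is "_ \<longleftrightarrow> ?S \<and> ?B")
    if c: "c \<ge> 0" for \<xi> c
  proof -
    have "(\<forall>v F. finite F \<longrightarrow> F \<subseteq> {x \<in> verts \<Lambda>. src \<Lambda> x = v} \<longrightarrow>
        (\<Sum>x\<in>F. (cmod (\<xi> x))\<^sup>2) \<le> c\<^sup>2) \<longleftrightarrow> (\<forall>v \<in> verts \<Lambda>. (cmod (\<xi> v))\<^sup>2 \<le> c\<^sup>2)"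
      unfolding P by (auto simp: subset_singleton_iff split: if_splits)
    also have "\<dots> \<longleftrightarrow> (\<forall>v \<in> verts \<Lambda>. cmod (\<xi> v) \<le> c)"
      using c by (simp add: abs_le_square_iff[symmetric])
    finally have e: "(\<forall>v F. finite F \<longrightarrow> F \<subseteq> {x \<in> verts \<Lambda>. src \<Lambda> x = v} \<longrightarrow>
        (\<Sum>x\<in>F. (cmod (\<xi> x))\<^sup>2) \<le> c\<^sup>2) \<longleftrightarrow> (\<forall>v \<in> verts \<Lambda>. cmod (\<xi> v) \<le> c)" .
    have "cmod (\<xi> x) \<le> c" if ?S "\<forall>v \<in> verts \<Lambda>. cmod (\<xi> v) \<le> c" for x
      using that c by (cases "x \<in> verts \<Lambda>") auto
    then show ?thesis unfolding bounded_sections_iff[OF c] e by blast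
  qed
  show ?thesis
  proof (intro set_eqI iffI)
    fix \<xi> assume \<xi>: "\<xi> \<in> fibre \<Lambda> 0"
    have "finite {v \<in> verts \<Lambda>. cmod (\<xi> v) \<ge> \<epsilon>}" if "\<epsilon> > 0" for \<epsilon>
    proof -
      from \<xi> that obtain \<eta> where \<eta>: "\<eta> \<in> c00 (verts \<Lambda>)" "mod_norm \<Lambda> 0 (\<xi> - \<eta>) < \<epsilon>"
        by (auto simp: fibre_def)
      have d: "\<xi> - \<eta> \<in> bounded_sections \<Lambda> 0"
        using \<xi> subsetD[OF c00_subset_fibre \<eta>(1)] bounded_sections_diff[of \<xi> \<Lambda> 0 \<eta>]
        by (simp add: fibre_def)
      have "{v \<in> verts \<Lambda>. cmod (\<xi> v) \<ge> \<epsilon>} \<subseteq> {v. \<eta> v \<noteq> 0}"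
      proof (intro subsetI CollectI notI)
        fix v assume "v \<in> {v \<in> verts \<Lambda>. cmod (\<xi> v) \<ge> \<epsilon>}" "\<eta> v = 0"
        then show False using mod_norm_pointwise_le[OF d, of v] \<eta>(2) by simp
      qed
      then show ?thesis using \<eta>(1) finite_subset by (auto simp: c00_def)
    qed
    then show "\<xi> \<in> coeff \<Lambda>" using \<xi> by (auto simp: c0_def fibre_def bounded_sections_def)
  next
    fix \<xi> assume \<xi>: "\<xi> \<in> coeff \<Lambda>"
    have *: "\<exists>\<eta> \<in> c00 (verts \<Lambda>). \<xi> - \<eta> \<in> bounded_sections \<Lambda> 0 \<and> mod_norm \<Lambda> 0 (\<xi> - \<eta>) \<le> \<epsilon>"
      if e: "\<epsilon> > 0" for \<epsilon>
    proof -
      define \<eta> where "\<eta> = (\<lambda>v. if cmod (\<xi> v) \<ge> \<epsilon> then \<xi> v else 0)"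
      have "{v. \<eta> v \<noteq> 0} \<subseteq> {v \<in> verts \<Lambda>. cmod (\<xi> v) \<ge> \<epsilon>}"
        using \<xi> by (auto simp: \<eta>_def c0_def split: if_splits)
      moreover have "finite {v \<in> verts \<Lambda>. cmod (\<xi> v) \<ge> \<epsilon>}" using \<xi> e by (simp add: c0_def)
      ultimately have "finite {v. \<eta> v \<noteq> 0}" by (rule finite_subset)
      then have "\<eta> \<in> c00 (verts \<Lambda>)" using \<xi> by (auto simp: c00_def \<eta>_def c0_def)
      moreover have "\<xi> - \<eta> \<in> bounded_sections \<Lambda> 0 \<and> mod_norm \<Lambda> 0 (\<xi> - \<eta>) \<le> \<epsilon>"
        using e \<xi> by (subst char) (auto simp: \<eta>_def c0_def)
      ultimately show ?thesis by blast
    qed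
    from *[of 1] obtain \<eta> where \<eta>: "\<eta> \<in> c00 (verts \<Lambda>)" "\<xi> - \<eta> \<in> bounded_sections \<Lambda> 0" by auto
    have "- \<eta> \<in> c00 (verts \<Lambda>)" using \<eta>(1) by (simp add: c00_def)
    then have "- \<eta> \<in> bounded_sections \<Lambda> 0" using c00_subset_fibre by (auto simp: fibre_def)
    from bounded_sections_diff[OF \<eta>(2) this]
    have "(\<xi> - \<eta>) - (- \<eta>) \<in> bounded_sections \<Lambda> 0" by blast
    then have "\<xi> \<in> bounded_sections \<Lambda> 0" by (simp add: fun_diff_def)
    moreover have "\<exists>\<eta> \<in> c00 (verts \<Lambda>). mod_norm \<Lambda> 0 (\<xi> - \<eta>) < \<epsilon>" if "\<epsilon> > 0" for \<epsilon>
    proof -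
      obtain \<eta> where "\<eta> \<in> c00 (verts \<Lambda>)" "mod_norm \<Lambda> 0 (\<xi> - \<eta>) \<le> \<epsilon> / 2"
        using *[of "\<epsilon> / 2"] \<open>\<epsilon> > 0\<close> by auto
      then show ?thesis using \<open>\<epsilon> > 0\<close> by (intro bexI[of _ \<eta>]) auto
    qed
    ultimately show "\<xi> \<in> fibre \<Lambda> 0" by (simp add: fibre_def)
  qed
qed


section \<open>Families of ideals\<close>

text \<open>Families indexed by the subsets of \<open>[k]\<close> are functions on \<open>nat set\<close>; their values off
  \<open>Pow {1..k}\<close> are irrelevant.\<close>

definition pow_tuple :: "nat \<Rightarrow> 'm kgraph \<Rightarrow> (nat set \<Rightarrow> ('m \<Rightarrow> complex) set) \<Rightarrow> bool" where
  "pow_tuple k \<Lambda> L \<longleftrightarrow> (\<forall>F \<subseteq> {1..k}. L F \<noteq> {} \<and> L F \<subseteq> coeff \<Lambda>)"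

definition consists_of_ideals :: "nat \<Rightarrow> 'm kgraph \<Rightarrow> (nat set \<Rightarrow> ('m \<Rightarrow> complex) set) \<Rightarrow> bool" where
  "consists_of_ideals k \<Lambda> L \<longleftrightarrow> (\<forall>F \<subseteq> {1..k}. closed_ideal (coeff \<Lambda>) (L F))"

definition T_family :: "nat \<Rightarrow> 'm kgraph \<Rightarrow> (nat set \<Rightarrow> ('m \<Rightarrow> complex) set) \<Rightarrow> bool" where
  "T_family k \<Lambda> L \<longleftrightarrow> pow_tuple k \<Lambda> L \<and> consists_of_ideals k \<Lambda> L \<and>
     (\<forall>F. F \<subset> {1..k} \<longrightarrow> (\<forall>i \<in> {1..k} - F.
        L F = fibre_inv \<Lambda> (indicator {i}) (L F) \<inter> L (F \<union> {i})))"

definition relative_O_family ::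
  "nat \<Rightarrow> 'm kgraph \<Rightarrow> (nat set \<Rightarrow> ('m \<Rightarrow> complex) set) \<Rightarrow>
     (nat set \<Rightarrow> ('m \<Rightarrow> complex) set) \<Rightarrow> bool" where
  "relative_O_family k \<Lambda> K L \<longleftrightarrow> T_family k \<Lambda> L \<and> (\<forall>F \<subseteq> {1..k}. K F \<subseteq> L F)"

text \<open>\<open>H\<^sub>I\<close>; \<open>indicator {v}\<close> is the point mass \<open>\<delta>\<^sub>v\<close>.\<close>

definition vertex_set :: "'m kgraph \<Rightarrow> ('m \<Rightarrow> complex) set \<Rightarrow> 'm set" where
  "vertex_set \<Lambda> I = {v \<in> verts \<Lambda>. indicator {v} \<in> I}"

end

(* A closed ideal I of c_0(V) consists of the functions supported on {v. \<delta>_v \<in> I}, so ideals are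
   compared through their vertex sets. Inner products of sections lie in c_0 of the vertices, and
   testing against point masses of paths shows that X_n^{-1}(I) is the ideal with vertex set
   {v. s(v\<Lambda>^n) \<subseteq> H_I}. *)

theory Submission
  imports Defs
begin

lemma indicator_in_c0: "v \<in> V \<Longrightarrow> (indicator {v} :: 'm \<Rightarrow> complex) \<in> c0 V"
  unfolding c0_def
  by (auto simp: indicator_def intro!: finite_subset[of _ "{v}"] split: if_splits)

text \<open>Such a function is a finite linear combination of point masses, built up one vertex at a
  time.\<close>

lemma finitely_supported_in_closed_ideal:
  assumes I: "closed_ideal A I" and S: "finite S" and SI: "\<And>v. v \<in> S \<Longrightarrow> indicator {v} \<in> I"
  shows "(\<lambda>v. if v \<in> S then f v else 0) \<in> I"
  using S SI
proof (induction S)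
  case empty
  then show ?case using I by (simp add: closed_ideal_def zero_fun_def)
next
  case (insert w S)
  have "(\<lambda>v. f w * indicator {w} v) \<in> I"
    using I insert.prems by (simp add: closed_ideal_def)
  then have "(\<lambda>v. f w * indicator {w} v) + (\<lambda>v. if v \<in> S then f v else 0) \<in> I"
    using I insert by (simp add: closed_ideal_def)
  also have "(\<lambda>v. f w * indicator {w} v) + (\<lambda>v. if v \<in> S then f v else 0)
      = (\<lambda>v. if v \<in> insert w S then f v else 0)"
    using insert.hyps by (auto simp: fun_eq_iff indicator_def)
  finally show ?case .
qed

text \<open>Multiplying an element of \<open>I\<close> by a point mass isolates one of its values.
  Conversely, truncating \<open>f\<close> to the finite set where it is large gives elements of
  \<open>I\<close> that approximate \<open>f\<close> uniformly, and \<open>I\<close> is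
  closed.\<close>

lemma mem_closed_ideal_iff:
  assumes I: "closed_ideal (c0 V) I"
  shows "f \<in> I \<longleftrightarrow> f \<in> c0 V \<and> (\<forall>v. f v \<noteq> 0 \<longrightarrow> indicator {v} \<in> I)"
proof (intro iffI conjI allI impI)
  assume f: "f \<in> I"
  then show f0: "f \<in> c0 V" using I by (auto simp: closed_ideal_def)
  fix v assume v: "f v \<noteq> 0"
  then have "v \<in> V" using f0 by (auto simp: c0_def)
  then have "(indicator {v} :: 'a \<Rightarrow> complex) \<in> c0 V" by (rule indicator_in_c0)
  then have "indicator {v} * f \<in> I"
    using I f by (simp add: closed_ideal_def)
  \<comment> \<open>The product with the point mass is \<open>f v\<close> times that point mass, and
    \<open>f v\<close> is invertible.\<close>
  then have "(\<lambda>w. inverse (f v) * (indicator {v} * f) w) \<in> I"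
    using I unfolding closed_ideal_def by blast
  also have "(\<lambda>w. inverse (f v) * (indicator {v} * f) w) = indicator {v}"
    using v by (auto simp: fun_eq_iff indicator_def)
  finally show "indicator {v} \<in> I" .
next
  assume f: "f \<in> c0 V \<and> (\<forall>v. f v \<noteq> 0 \<longrightarrow> indicator {v} \<in> I)"
  have "\<exists>g \<in> I. sup_norm (f - g) < \<epsilon>" if \<epsilon>: "\<epsilon> > 0" for \<epsilon>
  proof -
    \<comment> \<open>The supremum only inherits a weak bound, so the threshold
      \<open>\<epsilon> / 2\<close> leaves room for the strict one.\<close>
    define S where "S = {v \<in> V. cmod (f v) \<ge> \<epsilon> / 2}"
    define g where "g = (\<lambda>v. if v \<in> S then f v else 0)"
    have "finite S" unfolding S_def using f half_gt_zero[OF \<epsilon>] unfolding c0_def by blast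
    moreover have "indicator {v} \<in> I" if "v \<in> S" for v
    proof -
      have "f v \<noteq> 0" using that \<epsilon> by (auto simp: S_def)
      then show ?thesis using f by blast
    qed
    ultimately have "g \<in> I"
      unfolding g_def by (rule finitely_supported_in_closed_ideal[OF I])
    have "cmod ((f - g) v) \<le> \<epsilon> / 2" for v
      using f \<epsilon> by (cases "v \<in> V") (auto simp: g_def S_def c0_def)
    then have "sup_norm (f - g) \<le> \<epsilon> / 2"
      unfolding sup_norm_def by (intro cSUP_least) auto
    then show ?thesis using \<open>g \<in> I\<close> \<epsilon> by (intro bexI[of _ g]) auto
  qed
  then show "f \<in> I" using I f unfolding closed_ideal_def by blast
qed

lemma mem_closed_ideal_vertex_set_iff:
  assumes "closed_ideal (coeff \<Lambda>) I"
  shows "f \<in> I \<longleftrightarrow> f \<in> coeff \<Lambda> \<and> (\<forall>v. f v \<noteq> 0 \<longrightarrow> v \<in> vertex_set \<Lambda> I)"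
  unfolding mem_closed_ideal_iff[OF assms, of f] vertex_set_def by (auto simp: c0_def)

lemma closed_ideal_subset_iff:
  assumes "closed_ideal (coeff \<Lambda>) I" "closed_ideal (coeff \<Lambda>) J"
  shows "I \<subseteq> J \<longleftrightarrow> vertex_set \<Lambda> I \<subseteq> vertex_set \<Lambda> J"
proof
  assume "vertex_set \<Lambda> I \<subseteq> vertex_set \<Lambda> J"
  then show "I \<subseteq> J"
    using mem_closed_ideal_vertex_set_iff[OF assms(1)] mem_closed_ideal_vertex_set_iff[OF assms(2)]
    by blast
qed (auto simp: vertex_set_def)

text \<open>The norm of the sum is a limit of norms of finite partial sums. This passes estimates
  over finite sets of paths on to inner products.\<close>

lemma norm_infsum_le_finite_sums:
  fixes f :: "'a \<Rightarrow> 'b :: real_normed_vector"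
  assumes "\<And>F. finite F \<Longrightarrow> F \<subseteq> A \<Longrightarrow> norm (sum f F) \<le> c"
  shows "norm (infsum f A) \<le> c"
proof (cases "f summable_on A")
  case True
  have "((\<lambda>F. norm (sum f F)) \<longlongrightarrow> norm (infsum f A)) (finite_subsets_at_top A)"
    by (intro tendsto_norm infsum_tendsto True)
  then show ?thesis
    by (rule tendsto_upperbound)
      (auto intro!: eventually_finite_subsets_at_top_weakI assms)
next
  case False
  \<comment> \<open>Here \<open>infsum\<close> takes its default value 0, and the empty sum gives
    \<open>0 \<le> c\<close>.\<close>
  then show ?thesis using assms[of "{}"] by (simp add: infsum_not_exists)
qed

lemma c0_bounded:
  assumes "a \<in> c0 V"
  obtains M where "M > 0" "\<And>v. cmod (a v) \<le> M"
proof -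
  have "finite {v \<in> V. cmod (a v) \<ge> 1}" using assms by (simp add: c0_def)
  then have fin: "finite ((\<lambda>v. cmod (a v)) ` {v \<in> V. cmod (a v) \<ge> 1})" by simp
  \<comment> \<open>The inserted 1 makes the set non-empty, bounds all the smaller values and keeps
    \<open>M\<close> positive.\<close>
  define M where "M = Max (insert 1 ((\<lambda>v. cmod (a v)) ` {v \<in> V. cmod (a v) \<ge> 1}))"
  have "M \<ge> 1" using fin by (simp add: M_def)
  moreover have "cmod (a v) \<le> M" for v
  proof (cases "v \<in> V \<and> cmod (a v) \<ge> 1")
    case True
    then show ?thesis unfolding M_def using fin by (intro Max_ge) auto
  next
    case False
    then have "cmod (a v) \<le> 1" using assms by (auto simp: c0_def)
    then show ?thesis using \<open>M \<ge> 1\<close> by simp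
  qed
  ultimately show ?thesis using that[of M] by auto
qed

text \<open>A source is its own range, and ranges have degree 0.\<close>

lemma (in k_graph) src_verts: "x \<in> paths \<Lambda> n \<Longrightarrow> src \<Lambda> x \<in> verts \<Lambda>"
  using deg_id[OF src_mor] by (auto simp: paths_def rng_src src_mor)

text \<open>Approximate \<open>\<xi>\<close> by a finitely supported \<open>\<zeta>\<close>. Away
  from the finitely many sources of paths in the support of \<open>\<zeta>\<close>,
  \<open>\<xi>\<close> agrees with the small section \<open>\<xi> - \<zeta>\<close>, so
  Cauchy-Schwarz makes the inner product small there.\<close>

lemma (in k_graph) inner_prod_left_act_in_coeff:
  assumes a: "a \<in> coeff \<Lambda>" and \<xi>: "\<xi> \<in> fibre \<Lambda> n" and \<eta>: "\<eta> \<in> fibre \<Lambda> n"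
  shows "inner_prod \<Lambda> n \<xi> (left_act \<Lambda> a \<eta>) \<in> coeff \<Lambda>"
proof -
  let ?h = "inner_prod \<Lambda> n \<xi> (left_act \<Lambda> a \<eta>)"
  have "?h v = 0" if "v \<notin> verts \<Lambda>" for v
  proof -
    have "{x \<in> paths \<Lambda> n. src \<Lambda> x = v} = {}" using that src_verts by auto
    then show ?thesis by (simp only: inner_prod_def infsum_empty)
  qed
  moreover have "finite {v \<in> verts \<Lambda>. cmod (?h v) \<ge> \<epsilon>}" if \<epsilon>: "\<epsilon> > 0" for \<epsilon>
  proof -
    obtain M where M: "M > 0" "\<And>v. cmod (a v) \<le> M" using c0_bounded[OF a] by metis
    \<comment> \<open>Adding 1 keeps \<open>N\<close> positive even when \<open>\<eta>\<close> has
      norm 0, so that \<open>\<delta>\<close> may have \<open>N\<close> in its denominator.\<close>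
    define N where "N = mod_norm \<Lambda> n \<eta> + 1"
    have \<eta>b: "\<eta> \<in> bounded_sections \<Lambda> n" and \<xi>b: "\<xi> \<in> bounded_sections \<Lambda> n"
      using \<xi> \<eta> by (auto simp: fibre_def)
    have N: "N > 0" "mod_norm \<Lambda> n \<eta> \<le> N" using mod_norm_nonneg[OF \<eta>b] by (auto simp: N_def)
    \<comment> \<open>Chosen so that the final bound \<open>M * (\<delta> * N)\<close> equals
      \<open>\<epsilon> / 2\<close>, strictly below \<open>\<epsilon>\<close>.\<close>
    define \<delta> where "\<delta> = \<epsilon> / (2 * M * N)"
    have \<delta>: "\<delta> > 0" using \<epsilon> M N by (simp add: \<delta>_def)
    then obtain \<zeta> where \<zeta>: "\<zeta> \<in> c00 (paths \<Lambda> n)" "mod_norm \<Lambda> n (\<xi> - \<zeta>) < \<delta>"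
      using \<xi> by (auto simp: fibre_def)
    have \<zeta>b: "\<zeta> \<in> bounded_sections \<Lambda> n" using \<zeta>(1) c00_subset_fibre by (auto simp: fibre_def)
    have d: "\<xi> - \<zeta> \<in> bounded_sections \<Lambda> n" using bounded_sections_diff[OF \<xi>b \<zeta>b] by blast
    have small: "cmod (?h v) \<le> \<epsilon> / 2" if v: "v \<notin> src \<Lambda> ` {x. \<zeta> x \<noteq> 0}" for v
      unfolding inner_prod_def
    proof (rule norm_infsum_le_finite_sums)
      fix F assume F: "finite F" "F \<subseteq> {x \<in> paths \<Lambda> n. src \<Lambda> x = v}"
      have \<zeta>0: "\<zeta> x = 0" if "x \<in> F" for x using v F that by auto
      have "L2_set (\<lambda>x. cmod (\<xi> x)) F = L2_set (\<lambda>x. cmod ((\<xi> - \<zeta>) x)) F"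
        by (rule L2_set_cong) (auto simp: \<zeta>0)
      also have "\<dots> \<le> mod_norm \<Lambda> n (\<xi> - \<zeta>)"
        unfolding L2_set_def by (rule real_le_lsqrt[OF mod_norm_nonneg[OF d] mod_norm_sum_le[OF d F]])
      finally have 1: "L2_set (\<lambda>x. cmod (\<xi> x)) F \<le> \<delta>" using \<zeta>(2) by simp
      have "L2_set (\<lambda>x. cmod (\<eta> x)) F \<le> mod_norm \<Lambda> n \<eta>"
        unfolding L2_set_def by (rule real_le_lsqrt[OF mod_norm_nonneg[OF \<eta>b] mod_norm_sum_le[OF \<eta>b F]])
      then have 2: "L2_set (\<lambda>x. cmod (\<eta> x)) F \<le> N" using N(2) by simp
      have "cmod (\<Sum>x\<in>F. cnj (\<xi> x) * left_act \<Lambda> a \<eta> x)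
          \<le> (\<Sum>x\<in>F. cmod (cnj (\<xi> x) * left_act \<Lambda> a \<eta> x))"
        by (rule norm_sum)
      \<comment> \<open>The absolute values around the norms match the form of Cauchy-Schwarz in
        \<open>L2_set_mult_ineq\<close>.\<close>
      also have "\<dots> \<le> (\<Sum>x\<in>F. M * (\<bar>cmod (\<xi> x)\<bar> * \<bar>cmod (\<eta> x)\<bar>))"
      proof (rule sum_mono)
        fix x
        have "cmod (a (rng \<Lambda> x)) * (cmod (\<xi> x) * cmod (\<eta> x)) \<le> M * (cmod (\<xi> x) * cmod (\<eta> x))"
          by (rule mult_right_mono[OF M(2)]) simp
        then show "cmod (cnj (\<xi> x) * left_act \<Lambda> a \<eta> x) \<le> M * (\<bar>cmod (\<xi> x)\<bar> * \<bar>cmod (\<eta> x)\<bar>)"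
          by (simp add: left_act_def norm_mult mult_ac)
      qed
      also have "\<dots> = M * (\<Sum>x\<in>F. \<bar>cmod (\<xi> x)\<bar> * \<bar>cmod (\<eta> x)\<bar>)"
        by (simp add: sum_distrib_left)
      also have "\<dots> \<le> M * (L2_set (\<lambda>x. cmod (\<xi> x)) F * L2_set (\<lambda>x. cmod (\<eta> x)) F)"
        using M(1) by (intro mult_left_mono L2_set_mult_ineq) simp
      also have "\<dots> \<le> M * (\<delta> * N)"
        using M(1) \<delta> 1 2 by (intro mult_left_mono mult_mono) (auto simp: L2_set_nonneg)
      also have "\<dots> = \<epsilon> / 2" using M(1) N(1) by (simp add: \<delta>_def)
      finally show "cmod (\<Sum>x\<in>F. cnj (\<xi> x) * left_act \<Lambda> a \<eta> x) \<le> \<epsilon> / 2" .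
    qed
    have "{v \<in> verts \<Lambda>. cmod (?h v) \<ge> \<epsilon>} \<subseteq> src \<Lambda> ` {x. \<zeta> x \<noteq> 0}"
      using small \<epsilon> by fastforce
    then show ?thesis using \<zeta>(1) by (auto simp: c00_def intro: finite_subset)
  qed
  ultimately show ?thesis by (simp add: c0_def)
qed

text \<open>Only the term at \<open>x\<close> survives in the sum over paths with source
  \<open>src \<Lambda> x\<close>. Thus point masses of paths detect the values of \<open>a\<close>
  at ranges.\<close>

lemma inner_prod_point_mass:
  assumes "x \<in> paths \<Lambda> n"
  shows "inner_prod \<Lambda> n (indicator {x}) (left_act \<Lambda> a (indicator {x})) (src \<Lambda> x) = a (rng \<Lambda> x)"
proof -
  have "inner_prod \<Lambda> n (indicator {x}) (left_act \<Lambda> a (indicator {x})) (src \<Lambda> x)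
      = (\<Sum>\<^sub>\<infinity>y\<in>{x}. a (rng \<Lambda> y))"
    unfolding inner_prod_def left_act_def
    by (rule infsum_cong_neutral) (use assms in \<open>auto simp: indicator_def\<close>)
  then show ?thesis by simp
qed

text \<open>If \<open>a v \<noteq> 0\<close>, the point mass of a path into \<open>v\<close> yields
  an element of \<open>I\<close> that is non-zero at the source of that path. Conversely, an inner
  product that is non-zero at \<open>v\<close> has a non-zero summand, hence a path with source
  \<open>v\<close> whose range lies in the support of \<open>a\<close>.\<close>

lemma (in k_graph) mem_fibre_inv_iff:
  assumes I: "closed_ideal (coeff \<Lambda>) I"
  shows "a \<in> fibre_inv \<Lambda> n I \<longleftrightarrow> a \<in> coeff \<Lambda> \<and>
    (\<forall>v. a v \<noteq> 0 \<longrightarrow> src \<Lambda> ` paths_to \<Lambda> v n \<subseteq> vertex_set \<Lambda> I)"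
proof (intro iffI conjI allI impI)
  assume a: "a \<in> fibre_inv \<Lambda> n I"
  then show "a \<in> coeff \<Lambda>" by (simp add: fibre_inv_def)
  fix v assume v: "a v \<noteq> 0"
  show "src \<Lambda> ` paths_to \<Lambda> v n \<subseteq> vertex_set \<Lambda> I"
  proof clarify
    fix x assume "x \<in> paths_to \<Lambda> v n"
    then have x: "x \<in> paths \<Lambda> n" "rng \<Lambda> x = v" by (auto simp: paths_to_def)
    have "indicator {x} \<in> c00 (paths \<Lambda> n)" using x by (auto simp: c00_def indicator_def)
    then have "indicator {x} \<in> fibre \<Lambda> n" using c00_subset_fibre by blast
    then have "inner_prod \<Lambda> n (indicator {x}) (left_act \<Lambda> a (indicator {x})) \<in> I"
      using a by (simp add: fibre_inv_def)
    moreover have "inner_prod \<Lambda> n (indicator {x}) (left_act \<Lambda> a (indicator {x})) (src \<Lambda> x) \<noteq> 0"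
      using inner_prod_point_mass[OF x(1)] x(2) v by simp
    ultimately show "src \<Lambda> x \<in> vertex_set \<Lambda> I"
      using mem_closed_ideal_vertex_set_iff[OF I] by blast
  qed
next
  assume a: "a \<in> coeff \<Lambda> \<and> (\<forall>v. a v \<noteq> 0 \<longrightarrow> src \<Lambda> ` paths_to \<Lambda> v n \<subseteq> vertex_set \<Lambda> I)"
  have "inner_prod \<Lambda> n \<xi> (left_act \<Lambda> a \<eta>) \<in> I" if "\<xi> \<in> fibre \<Lambda> n" "\<eta> \<in> fibre \<Lambda> n" for \<xi> \<eta>
    unfolding mem_closed_ideal_vertex_set_iff[OF I]
  proof (intro conjI allI impI)
    show "inner_prod \<Lambda> n \<xi> (left_act \<Lambda> a \<eta>) \<in> coeff \<Lambda>"
      using inner_prod_left_act_in_coeff a that by blast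
    fix v assume v: "inner_prod \<Lambda> n \<xi> (left_act \<Lambda> a \<eta>) v \<noteq> 0"
    have "\<exists>x \<in> {x \<in> paths \<Lambda> n. src \<Lambda> x = v}. cnj (\<xi> x) * left_act \<Lambda> a \<eta> x \<noteq> 0"
      using v unfolding inner_prod_def by (meson infsum_0)
    then obtain x where "x \<in> paths \<Lambda> n" "src \<Lambda> x = v" "a (rng \<Lambda> x) \<noteq> 0"
      by (auto simp: left_act_def)
    then show "v \<in> vertex_set \<Lambda> I" using a by (auto simp: paths_to_def)
  qed
  then show "a \<in> fibre_inv \<Lambda> n I" using a by (simp add: fibre_inv_def)
qed

lemma (in k_graph) vertex_set_fibre_inv:
  assumes "closed_ideal (coeff \<Lambda>) I"
  shows "vertex_set \<Lambda> (fibre_inv \<Lambda> n I) =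
    {v \<in> verts \<Lambda>. src \<Lambda> ` paths_to \<Lambda> v n \<subseteq> vertex_set \<Lambda> I}"
  by (auto simp: vertex_set_def[of _ "fibre_inv \<Lambda> n I"] mem_fibre_inv_iff[OF assms]
      indicator_in_c0 indicator_def)

text \<open>Taking vertex sets commutes with intersections, which gives one direction. For the
  other, membership in each of the three sets is a condition on the support of \<open>a\<close>, and
  equality of vertex sets matches these conditions vertex by vertex.\<close>

lemma (in k_graph) eq_fibre_inv_inter_iff:
  assumes I: "closed_ideal (coeff \<Lambda>) I" and J: "closed_ideal (coeff \<Lambda>) J"
  shows "I = fibre_inv \<Lambda> n I \<inter> J \<longleftrightarrow>
    vertex_set \<Lambda> I =
      {v \<in> verts \<Lambda>. src \<Lambda> ` paths_to \<Lambda> v n \<subseteq> vertex_set \<Lambda> I} \<inter> vertex_set \<Lambda> J"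
proof
  assume "I = fibre_inv \<Lambda> n I \<inter> J"
  then have "vertex_set \<Lambda> I = vertex_set \<Lambda> (fibre_inv \<Lambda> n I) \<inter> vertex_set \<Lambda> J"
    by (auto simp: vertex_set_def)
  then show "vertex_set \<Lambda> I =
      {v \<in> verts \<Lambda>. src \<Lambda> ` paths_to \<Lambda> v n \<subseteq> vertex_set \<Lambda> I} \<inter> vertex_set \<Lambda> J"
    by (simp only: vertex_set_fibre_inv[OF I])
next
  assume H: "vertex_set \<Lambda> I =
      {v \<in> verts \<Lambda>. src \<Lambda> ` paths_to \<Lambda> v n \<subseteq> vertex_set \<Lambda> I} \<inter> vertex_set \<Lambda> J"
  have "a \<in> I \<longleftrightarrow> a \<in> fibre_inv \<Lambda> n I \<inter> J" for a
  proof -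
    have "v \<in> vertex_set \<Lambda> I \<longleftrightarrow>
        src \<Lambda> ` paths_to \<Lambda> v n \<subseteq> vertex_set \<Lambda> I \<and> v \<in> vertex_set \<Lambda> J" for v
      \<comment> \<open>Membership in \<open>vertex_set \<Lambda> J\<close> already provides
        \<open>v \<in> verts \<Lambda>\<close>.\<close>
      by (subst H) (auto simp: vertex_set_def[of _ J])
    then show ?thesis
      unfolding Int_iff mem_fibre_inv_iff[OF I] mem_closed_ideal_vertex_set_iff[OF I, of a]
        mem_closed_ideal_vertex_set_iff[OF J, of a]
      by blast
  qed
  then show "I = fibre_inv \<Lambda> n I \<inter> J" by blast
qed

theorem corollaryD:
  fixes k :: nat and \<Lambda> :: "'m kgraph"
    and K L :: "nat set \<Rightarrow> ('m \<Rightarrow> complex) set"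
  assumes "k_graph \<Lambda> k" and "row_finite k \<Lambda>"
    and "pow_tuple k \<Lambda> K" and "pow_tuple k \<Lambda> L"
    and "consists_of_ideals k \<Lambda> K"
  shows "relative_O_family k \<Lambda> K L \<longleftrightarrow>
    consists_of_ideals k \<Lambda> L \<and>
    (\<forall>F. F \<subset> {1..k} \<longrightarrow> (\<forall>i \<in> {1..k} - F.
       vertex_set \<Lambda> (L F) =
         {v \<in> verts \<Lambda>. src \<Lambda> ` paths_to \<Lambda> v (indicator {i}) \<subseteq> vertex_set \<Lambda> (L F)}
           \<inter> vertex_set \<Lambda> (L (F \<union> {i})))) \<and>
    (\<forall>F \<subseteq> {1..k}. vertex_set \<Lambda> (K F) \<subseteq> vertex_set \<Lambda> (L F))"
proof (cases "consists_of_ideals k \<Lambda> L")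
  \<comment> \<open>Both sides assert that \<open>L\<close> consists of ideals. Under this
    assumption the remaining conditions correspond one by one; without it both sides are
    false.\<close>
  case True
  interpret k_graph \<Lambda> k by fact
  have L: "closed_ideal (coeff \<Lambda>) (L F)" and K: "closed_ideal (coeff \<Lambda>) (K F)"
    if "F \<subseteq> {1..k}" for F
    using True assms(5) that by (auto simp: consists_of_ideals_def)
  have T: "L F = fibre_inv \<Lambda> (indicator {i}) (L F) \<inter> L (F \<union> {i}) \<longleftrightarrow>
      vertex_set \<Lambda> (L F) =
         {v \<in> verts \<Lambda>. src \<Lambda> ` paths_to \<Lambda> v (indicator {i}) \<subseteq> vertex_set \<Lambda> (L F)}
           \<inter> vertex_set \<Lambda> (L (F \<union> {i}))" if "F \<subset> {1..k}" "i \<in> {1..k} - F" for F i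
    using that by (intro eq_fibre_inv_inter_iff L) auto
  have O: "K F \<subseteq> L F \<longleftrightarrow> vertex_set \<Lambda> (K F) \<subseteq> vertex_set \<Lambda> (L F)" if "F \<subseteq> {1..k}" for F
    using that by (intro closed_ideal_subset_iff L K)
  show ?thesis
    unfolding relative_O_family_def T_family_def using True assms(4)
    \<comment> \<open>The congruence rules supply the bounds on \<open>F\<close> and
      \<open>i\<close> under which \<open>T\<close> and \<open>O\<close> rewrite.\<close>
    by (simp only: simp_thms T O cong: imp_cong ball_cong)
next
  case False
  then show ?thesis by (simp add: relative_O_family_def T_family_def)
qed

end
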